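(* Let $H_i(k)$ be the horizon selected by the variable-horizon policy $$H_i(k)=\begin{cases}\operatorname{clip}\Big(\max_{j\in\mathcal{C}_i}\lceil\tau^*_{ij}/\Delta t\rceil,\ H_{\min},\ H_{\max}\Big), & \mathcal{C}_i\neq\emptyset,\\ H_{\min}, & \mathcal{C}_i=\emptyset,\end{cases}$$ where $0<H_{\min}\le H_{\max}$ are fixed integers. Let $\mathcal{C}_i \neq \emptyset$. Then the policy covers every predicted conflict, $H_i(k)\,\Delta t \geq \tau^{*}_{ij}$ for all $j \in \mathcal{C}_i$, and it is minimal: every integer horizon $H \in [H_{\min}, H_{\max}]$ whose window covers all predicted conflicts (i.e. $H\Delta t\ge\tau^*_{ij}$ for all $j\in\mathcal{C}_i$) satisfies $H \geq H_i(k)$. If $\mathcal{C}_i = \emptyset$, the policy returns the smallest admissible horizon $H_{\min}$.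
   Context: $\Delta t>0$ is the sampling time and $t_{\max}=H_{\max}\Delta t$ the prediction window. A horizon is admissible if it is an integer in $[H_{\min},H_{\max}]$; $\operatorname{clip}(x,a,b)=\operatorname{clamp}(x,a,b)=\min(\max(x,a),b)$. Drone $i$ has a finite neighbor set $\mathcal{N}_i$. Drone $i$ and each neighbor $j$ have predicted straight flight lines $\mathbf{p}_i+\tau\tilde{\mathbf{v}}_i$ and $\mathbf{p}_j+\tau\tilde{\mathbf{v}}_j$ in $\mathbb{R}^3$, $\tau\in[0,t_{\max}]$. With $\Delta\mathbf{p}_{ij}=\mathbf{p}_i-\mathbf{p}_j$, $\Delta\mathbf{v}_{ij}=\tilde{\mathbf{v}}_i-\tilde{\mathbf{v}}_j$ and a constant $\epsilon_0>0$, the time of closest approach is $\tau^*_{ij}=\operatorname{clamp}(-\Delta\mathbf{p}_{ij}^\top\Delta\mathbf{v}_{ij}/\|\Delta\mathbf{v}_{ij}\|^2,0,t_{\max})$ if $\|\Delta\mathbf{v}_{ij}\|>\epsilon_0$ and $\tau^*_{ij}=0$ otherwise, and the gap is $g_{ij}=\|\Delta\mathbf{p}_{ij}+\tau^*_{ij}\Delta\mathbf{v}_{ij}\|$. The funnel radius is $\psi_{ij}(\tau)=r_{\mathrm{f}}+(r_{\max}-r_{\mathrm{f}})\exp(-\tau/(t_{\max}c_{\mathrm{d}}))$, where $c_{\mathrm{d}}>0$, $r_{\max}=r_{\min}+\alpha V_{\max}^2/(2U_{\max})$, $r_{\mathrm{f}}=r_{\min}+\alpha\hat v_j^2/(2U_{\max})$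 with $\hat v_j$ the fitted speed of neighbor $j$, and $r_{\min},V_{\max},U_{\max}>0$, $\alpha\in(0,1]$. Neighbor $j$ is in predicted conflict when $g_{ij}\le\psi_{ij}(\tau^*_{ij})$, and $\mathcal{C}_i=\{j\in\mathcal{N}_i:g_{ij}\le\psi_{ij}(\tau^*_{ij})\}$. *)

theory Defs
  imports "HOL-Analysis.Analysis"
begin

record policy_params =
  dt :: real
  H_min :: int
  H_max :: int
  eps0 :: real
  c_d :: real
  r_min :: real
  V_max :: real
  U_max :: real
  alpha :: real

text \<open>
  Prediction data at one time step. The fitted speed is a separate datum,
  not tied to the norm of the predicted velocity.
\<close>

record 'd prediction =
  nbrs :: "'d \<Rightarrow> 'd set"
  pos :: "'d \<Rightarrow> real ^ 3"
  vel :: "'d \<Rightarrow> real ^ 3"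
  fitted_speed :: "'d \<Rightarrow> real"

definition clip :: "'a::linorder \<Rightarrow> 'a \<Rightarrow> 'a \<Rightarrow> 'a" where
  "clip x a b = min (max x a) b"

definition t_max :: "policy_params \<Rightarrow> real" where
  "t_max P = real_of_int (H_max P) * dt P"

definition admissible :: "policy_params \<Rightarrow> int \<Rightarrow> bool" where
  "admissible P H \<longleftrightarrow> H_min P \<le> H \<and> H \<le> H_max P"

definition rel_pos :: "'d prediction \<Rightarrow> 'd \<Rightarrow> 'd \<Rightarrow> real ^ 3" where
  "rel_pos S i j = pos S i - pos S j"

definition rel_vel :: "'d prediction \<Rightarrow> 'd \<Rightarrow> 'd \<Rightarrow> real ^ 3" where
  "rel_vel S i j = vel S i - vel S j"

definition tau_star :: "policy_params \<Rightarrow> 'd prediction \<Rightarrow> 'd \<Rightarrow> 'd \<Rightarrow> real" where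
  "tau_star P S i j =
     (if norm (rel_vel S i j) > eps0 P
      then clip (- (rel_pos S i j \<bullet> rel_vel S i j) / (norm (rel_vel S i j))\<^sup>2) 0 (t_max P)
      else 0)"

definition gap :: "policy_params \<Rightarrow> 'd prediction \<Rightarrow> 'd \<Rightarrow> 'd \<Rightarrow> real" where
  "gap P S i j = norm (rel_pos S i j + tau_star P S i j *\<^sub>R rel_vel S i j)"

definition r_max :: "policy_params \<Rightarrow> real" where
  "r_max P = r_min P + alpha P * (V_max P)\<^sup>2 / (2 * U_max P)"

definition r_f :: "policy_params \<Rightarrow> 'd prediction \<Rightarrow> 'd \<Rightarrow> real" where
  "r_f P S j = r_min P + alpha P * (fitted_speed S j)\<^sup>2 / (2 * U_max P)"

text \<open>
  The drone \<open>i\<close> that owns the funnel does not occur: the radius depends on the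
  pair only through the neighbor \<open>j\<close>.
\<close>

definition funnel_radius :: "policy_params \<Rightarrow> 'd prediction \<Rightarrow> 'd \<Rightarrow> real \<Rightarrow> real" where
  "funnel_radius P S j \<tau> =
     r_f P S j + (r_max P - r_f P S j) * exp (- \<tau> / (t_max P * c_d P))"

definition conflicts :: "policy_params \<Rightarrow> 'd prediction \<Rightarrow> 'd \<Rightarrow> 'd set" where
  "conflicts P S i = {j \<in> nbrs S i. gap P S i j \<le> funnel_radius P S j (tau_star P S i j)}"

definition horizon :: "policy_params \<Rightarrow> 'd prediction \<Rightarrow> 'd \<Rightarrow> int" where
  "horizon P S i =
     (if conflicts P S i \<noteq> {}
      then clip (Max ((\<lambda>j. \<lceil>tau_star P S i j / dt P\<rceil>) ` conflicts P S i)) (H_min P) (H_max P)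
      else H_min P)"

definition covers_conflicts :: "policy_params \<Rightarrow> 'd prediction \<Rightarrow> 'd \<Rightarrow> int \<Rightarrow> bool" where
  "covers_conflicts P S i H \<longleftrightarrow>
     (\<forall>j \<in> conflicts P S i. real_of_int H * dt P \<ge> tau_star P S i j)"

end

theory Submission
  imports Defs
begin

text \<open>
  A horizon \<open>H\<close> covers a conflict iff \<open>H \<ge> \<lceil>\<tau>\<^sup>* / \<Delta>t\<rceil>\<close>, so it covers all of them iff it is at
  least the maximum of these ceilings. As \<open>\<tau>\<^sup>* \<le> t_max = H_max \<Delta>t\<close>, that maximum is at most
  \<open>H_max\<close>, and the upper clipping never removes coverage.
\<close>

text \<open>The clipped branch is capped by \<open>t_max P\<close> outright; the hypothesis is for
  the default value 0 at small relative speed.\<close>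

lemma tau_star_le_t_max:
  assumes "0 \<le> t_max P"
  shows "tau_star P S i j \<le> t_max P"
  using assms by (simp add: tau_star_def clip_def)

lemma finite_conflicts: "finite (nbrs S i) \<Longrightarrow> finite (conflicts P S i)"
  by (simp add: conflicts_def)

lemma covers_conflicts_iff_Max_le:
  assumes "dt P > 0" "finite (conflicts P S i)" "conflicts P S i \<noteq> {}"
  shows "covers_conflicts P S i H \<longleftrightarrow>
    Max ((\<lambda>j. \<lceil>tau_star P S i j / dt P\<rceil>) ` conflicts P S i) \<le> H"
  using assms by (simp add: covers_conflicts_def ceiling_le_iff pos_divide_le_eq)

lemma covers_conflicts_H_max:
  assumes "dt P > 0" "0 \<le> H_max P"
  shows "covers_conflicts P S i (H_max P)"
  using tau_star_le_t_max[of P S i] assms by (simp add: covers_conflicts_def t_max_def)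

theorem mainTheorem6:
  fixes P :: policy_params
    and S :: "nat \<Rightarrow> 'd prediction"
    and i :: 'd and k :: nat
  assumes "dt P > 0"
    and "0 < H_min P" and "H_min P \<le> H_max P"
    and "eps0 P > 0" and "c_d P > 0"
    and "r_min P > 0" and "V_max P > 0" and "U_max P > 0"
    and "0 < alpha P" and "alpha P \<le> 1"
    and "finite (nbrs (S k) i)"
    and "\<forall>j \<in> nbrs (S k) i. fitted_speed (S k) j \<ge> 0"
  shows "(conflicts P (S k) i \<noteq> {} \<longrightarrow>
            covers_conflicts P (S k) i (horizon P (S k) i) \<and>
            (\<forall>H. admissible P H \<and> covers_conflicts P (S k) i H \<longrightarrow> H \<ge> horizon P (S k) i)) \<and>
         (conflicts P (S k) i = {} \<longrightarrow>
            horizon P (S k) i = H_min P \<and>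
            admissible P (horizon P (S k) i) \<and>
            (\<forall>H. admissible P H \<longrightarrow> horizon P (S k) i \<le> H))"
proof (cases "conflicts P (S k) i = {}")
  case True
  then show ?thesis
    using \<open>H_min P \<le> H_max P\<close> by (simp add: horizon_def admissible_def)
next
  case False
  \<comment> \<open>\<open>H\<close> stays schematic, so \<open>iff\<close> rewrites coverage by
    \<open>H_max P\<close>, by the selected horizon and by any competitor.\<close>
  note iff = covers_conflicts_iff_Max_le[OF \<open>dt P > 0\<close> finite_conflicts[OF \<open>finite (nbrs (S k) i)\<close>] False]
  have "covers_conflicts P (S k) i (H_max P)"
    using assms(1-3) by (intro covers_conflicts_H_max) auto
  \<comment> \<open>The maximum M of the ceilings is at most \<open>H_max P\<close>, so the horizon
    equals \<open>max M (H_min P)\<close>. It is at least M, which gives coverage; an admissible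
    covering \<open>H\<close> is above both arguments, which gives minimality.\<close>
  then show ?thesis
    using False unfolding iff by (simp add: horizon_def clip_def admissible_def)
qed

end
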